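(* Let $n\ge 3$ and let $X=\{x_1,x_2,\ldots,x_{n+2}\}$ be a set with $n+2$ elements. Let $S_n$ act on $X$ as follows: each $\sigma\in S_n$, regarded as a permutation of $\{1,\ldots,n\}$, sends $x_i$ to $x_{\sigma(i)}$ for $1\le i\le n$; and $\sigma$ interchanges $x_{n+1}$ and $x_{n+2}$ if $\sigma$ is odd, and fixes both $x_{n+1}$ and $x_{n+2}$ if $\sigma$ is even. Then the distinguishing number of this action is $D_{S_n}(X)=n-1$.
   Context: For a group $\Gamma$ acting faithfully on a finite set $X$, an $r$-distinguishing labeling is a function $\phi:X\to\{1,\ldots,r\}$ such that the only $g\in\Gamma$ with $\phi(gx)=\phi(x)$ for all $x\in X$ is the identity. The distinguishing number $D_\Gamma(X)$ is the smallest $r$ for which an $r$-distinguishing labeling exists. *)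

theory Defs
  imports "HOL-Algebra.Sym_Groups" "HOL-Algebra.Group_Action"
begin

definition distinguishing_labeling ::
  "('g, 'm) monoid_scheme \<Rightarrow> 'a set \<Rightarrow> ('g \<Rightarrow> 'a \<Rightarrow> 'a) \<Rightarrow> nat \<Rightarrow> ('a \<Rightarrow> nat) \<Rightarrow> bool"
  where "distinguishing_labeling G X \<phi> r c \<longleftrightarrow>
    c \<in> X \<rightarrow> {1..r} \<and>
    (\<forall>g\<in>carrier G. (\<forall>x\<in>X. c (\<phi> g x) = c x) \<longrightarrow> g = \<one>\<^bsub>G\<^esub>)"

definition distinguishing_number ::
  "('g, 'm) monoid_scheme \<Rightarrow> 'a set \<Rightarrow> ('g \<Rightarrow> 'a \<Rightarrow> 'a) \<Rightarrow> nat"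
  where "distinguishing_number G X \<phi> = (LEAST r. \<exists>c. distinguishing_labeling G X \<phi> r c)"

text \<open>For a faithful action on a finite set the minimum is over a nonempty set.\<close>

lemma (in faithful_action) ex_distinguishing_labeling:
  assumes "finite E"
  shows "\<exists>c. distinguishing_labeling G E \<phi> (card E) c"
proof -
  obtain c where c: "bij_betw c E {1..card E}"
    using assms finite_same_card_bij[of E "{1..card E}"] by auto
  have "g = \<one>" if g: "g \<in> carrier G" and fx: "\<forall>x\<in>E. c (\<phi> g x) = c x" for g
  proof -
    interpret h: group_hom G "BijGroup E" \<phi> by (rule group_hom)
    have bij: "\<phi> g \<in> Bij E" using h.hom_closed[OF g] by (simp add: BijGroup_def)
    have "\<phi> g x = x" if "x \<in> E" for x
      using fx that inj_onD[OF bij_betw_imp_inj_on[OF c]] Bij_imp_funcset[OF bij] by blast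
    moreover have "\<phi> \<one> = (\<lambda>x\<in>E. x)" using h.hom_one by (simp add: BijGroup_def)
    ultimately have "\<phi> g = \<phi> \<one>"
      using Bij_imp_extensional[OF bij] by (auto simp: fun_eq_iff extensional_def)
    then show ?thesis using inj_onD[OF faithful] g h.G.one_closed by blast
  qed
  moreover have "c \<in> E \<rightarrow> {1..card E}" using c by (rule bij_betw_imp_funcset)
  ultimately show ?thesis unfolding distinguishing_labeling_def by blast
qed

end

theory Submission
  imports Defs
begin

text \<open>Labels on the first \<open>n\<close> points separate every permutation up to one collision, and the last
  two points detect the odd permutation that this collision allows, so \<open>n - 1\<close> labels suffice.
  With fewer labels there are two different collisions among the first \<open>n\<close> points, and the product
  of the two corresponding transpositions is even, nontrivial and label preserving.\<close>

text \<open>Pigeonhole, stated for an arbitrary index set so that it can be applied again after a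
  point is deleted.\<close>

lemma ex_same_label:
  assumes "c \<in> A \<rightarrow> {1..r}" and "r < card A"
  obtains i j where "i \<in> A" "j \<in> A" "i \<noteq> j" "c i = c j"
proof -
  have "finite A" using assms(2) by (metis card.infinite not_less0)
  have "card (c ` A) \<le> r"
    using card_mono[of "{1..r}" "c ` A"] assms(1) by auto
  then have "\<not> inj_on c A" using assms(2) card_image by fastforce
  then show ?thesis using that by (auto simp: inj_on_def)
qed

lemma ex_even_label_preserving:
  fixes c :: "nat \<Rightarrow> nat"
  assumes c: "c \<in> {1..n} \<rightarrow> {1..r}" and r: "r + 1 < n"
  obtains \<sigma> where "\<sigma> permutes {1..n}" "evenperm \<sigma>" "\<sigma> \<noteq> id" "\<And>i. c (\<sigma> i) = c i"
proof -
  obtain i j where ij: "i \<in> {1..n}" "j \<in> {1..n}" "i \<noteq> j" "c i = c j"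
    using ex_same_label[OF c] r by auto
  \<comment> \<open>Deleting \<open>i\<close> leaves \<open>n - 1 > r\<close> points, so a second
    collision exists, and its pair differs from \<open>i, j\<close> because it avoids
    \<open>i\<close>. The two pairs may still share \<open>j\<close>.\<close>
  have "c \<in> {1..n} - {i} \<rightarrow> {1..r}" using c by auto
  moreover have "r < card ({1..n} - {i})" using ij(1) r by simp
  ultimately obtain k l where kl: "k \<in> {1..n} - {i}" "l \<in> {1..n} - {i}" "k \<noteq> l" "c k = c l"
    by (rule ex_same_label)
  let ?\<sigma> = "transpose i j \<circ> transpose k l"
  have "?\<sigma> permutes {1..n}"
    using ij kl by (intro permutes_compose permutes_swap_id) auto
  moreover have "evenperm ?\<sigma>"
    using ij kl by (simp add: evenperm_comp evenperm_swap permutation_swap_id)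
  \<comment> \<open>Since \<open>k\<close> and \<open>l\<close> differ from \<open>i\<close>, the
    inner transposition fixes \<open>i\<close> and the outer one sends it to
    \<open>j\<close>.\<close>
  moreover have "?\<sigma> i \<noteq> i" using ij kl by (auto simp: transpose_def)
  then have "?\<sigma> \<noteq> id" by (metis id_apply)
  moreover have "c (?\<sigma> m) = c m" for m using ij kl by (auto simp: transpose_def)
  ultimately show ?thesis using that by blast
qed

text \<open>That \<open>\<phi>\<close> is an action is derived from these equations. They fix
  \<open>\<phi> \<sigma>\<close> on \<open>X\<close> only; extensionality fixes it elsewhere, as
  membership in \<open>Bij X\<close> demands.\<close>

locale parity_extended_action =
  fixes n :: nat and X :: "'a set" and x :: "nat \<Rightarrow> 'a"
    and \<phi> :: "(nat \<Rightarrow> nat) \<Rightarrow> 'a \<Rightarrow> 'a"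
  assumes enum: "bij_betw x {1..n+2} X"
    and extensional: "\<And>\<sigma>. \<sigma> \<in> carrier (sym_group n) \<Longrightarrow> \<phi> \<sigma> \<in> extensional X"
    and act: "\<And>\<sigma> i. \<sigma> \<in> carrier (sym_group n) \<Longrightarrow> i \<in> {1..n} \<Longrightarrow> \<phi> \<sigma> (x i) = x (\<sigma> i)"
    and act_odd: "\<And>\<sigma>. \<sigma> \<in> carrier (sym_group n) \<Longrightarrow> \<not> evenperm \<sigma> \<Longrightarrow>
           \<phi> \<sigma> (x (n+1)) = x (n+2) \<and> \<phi> \<sigma> (x (n+2)) = x (n+1)"
    and act_even: "\<And>\<sigma>. \<sigma> \<in> carrier (sym_group n) \<Longrightarrow> evenperm \<sigma> \<Longrightarrow>
           \<phi> \<sigma> (x (n+1)) = x (n+1) \<and> \<phi> \<sigma> (x (n+2)) = x (n+2)"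
begin

lemma point_cases:
  assumes "y \<in> X"
  obtains i where "i \<in> {1..n}" "y = x i" | "y = x (n+1)" | "y = x (n+2)"
proof -
  obtain i where i: "i \<in> {1..n+2}" "y = x i"
    using assms enum by (auto simp: bij_betw_def)
  then consider "i \<in> {1..n}" | "i = n+1" | "i = n+2" by fastforce
  then show ?thesis using that i(2) by cases auto
qed

lemma x_mem: "i \<in> {1..n+2} \<Longrightarrow> x i \<in> X"
  using enum by (auto simp: bij_betw_def)

lemma x_eq_iff: "i \<in> {1..n+2} \<Longrightarrow> j \<in> {1..n+2} \<Longrightarrow> x i = x j \<longleftrightarrow> i = j"
  using enum by (auto simp: bij_betw_def inj_on_def)

lemma perm_mem: "\<sigma> \<in> carrier (sym_group n) \<Longrightarrow> i \<in> {1..n} \<Longrightarrow> \<sigma> i \<in> {1..n}"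
  using permutes_in_image[of \<sigma> "{1..n}" i] by (auto simp: sym_group_def)

lemma maps_to:
  assumes "\<sigma> \<in> carrier (sym_group n)" "y \<in> X"
  shows "\<phi> \<sigma> y \<in> X"
  using assms(2)
proof (cases rule: point_cases)
  case (1 i)
  then show ?thesis using act[OF assms(1)] x_mem[of "\<sigma> i"] perm_mem[OF assms(1)] by fastforce
qed (use assms act_odd act_even x_mem[of "n+1"] x_mem[of "n+2"] in \<open>cases "evenperm \<sigma>"; simp\<close>)+

text \<open>On the last two points the action factors through the sign, and the sign is
  multiplicative.\<close>

lemma act_comp:
  assumes "\<sigma> \<in> carrier (sym_group n)" "\<tau> \<in> carrier (sym_group n)" "y \<in> X"
  shows "\<phi> (\<sigma> \<circ> \<tau>) y = \<phi> \<sigma> (\<phi> \<tau> y)"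
proof -
  have c: "\<sigma> \<circ> \<tau> \<in> carrier (sym_group n)"
    using assms by (simp add: sym_group_def permutes_compose)
  have e: "evenperm (\<sigma> \<circ> \<tau>) \<longleftrightarrow> (evenperm \<sigma> \<longleftrightarrow> evenperm \<tau>)"
    using assms by (simp add: evenperm_comp sym_group_carrier')
  show ?thesis
    using assms(3)
  proof (cases rule: point_cases)
    case (1 i)
    then show ?thesis using act c assms perm_mem by simp
  qed (cases "evenperm \<sigma>"; cases "evenperm \<tau>";
       use act_odd[OF c] act_even[OF c] act_odd act_even assms e in simp)+
qed

lemma act_id:
  assumes "y \<in> X"
  shows "\<phi> id y = y"
  using assms
  by (cases rule: point_cases)
    (use act[of id] act_even[of id] in \<open>auto simp: sym_group_def permutes_id\<close>)

lemma bij: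
  assumes s: "\<sigma> \<in> carrier (sym_group n)"
  shows "\<phi> \<sigma> \<in> Bij X"
proof -
  have p: "\<sigma> permutes {1..n}" using s by (simp add: sym_group_def)
  have i: "inv_into UNIV \<sigma> \<in> carrier (sym_group n)"
    by (rule sym_group_inv_closed[OF s])
  have "bij_betw (\<phi> \<sigma>) X X"
  \<comment> \<open>The inverse permutation acts as the two-sided inverse, by
    \<open>act_comp\<close> and \<open>act_id\<close>.\<close>
  proof (rule bij_betw_byWitness[where f' = "\<phi> (inv_into UNIV \<sigma>)"])
    show "\<forall>y\<in>X. \<phi> (inv_into UNIV \<sigma>) (\<phi> \<sigma> y) = y"
      using act_comp[OF i s] act_id permutes_inv_o(2)[OF p] by simp
    show "\<forall>y\<in>X. \<phi> \<sigma> (\<phi> (inv_into UNIV \<sigma>) y) = y"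
      using act_comp[OF s i] act_id permutes_inv_o(1)[OF p] by simp
  qed (use maps_to s i in auto)
  then show ?thesis using extensional[OF s] by (simp add: Bij_def)
qed

lemma faithful: "faithful_action (sym_group n) X \<phi>"
proof -
  \<comment> \<open>Multiplication in \<open>BijGroup X\<close> is composition restricted to
    \<open>X\<close>, so agreement on \<open>X\<close> must be supplemented by extensionality of
    both sides.\<close>
  have "\<phi> (\<sigma> \<circ> \<tau>) = compose X (\<phi> \<sigma>) (\<phi> \<tau>)"
    if "\<sigma> \<in> carrier (sym_group n)" "\<tau> \<in> carrier (sym_group n)" for \<sigma> \<tau>
  proof (rule extensionalityI[of _ X])
    show "\<phi> (\<sigma> \<circ> \<tau>) \<in> extensional X"
      using that by (intro extensional) (simp add: sym_group_def permutes_compose)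
  qed (use that act_comp in \<open>auto simp: compose_def\<close>)
  then have "\<phi> \<in> hom (sym_group n) (BijGroup X)"
    using bij by (auto simp: hom_def BijGroup_def sym_group_mult)
  moreover have "inj_on \<phi> (carrier (sym_group n))"
  proof (rule inj_onI)
    fix \<sigma> \<tau> assume s: "\<sigma> \<in> carrier (sym_group n)" and t: "\<tau> \<in> carrier (sym_group n)"
      and eq: "\<phi> \<sigma> = \<phi> \<tau>"
    \<comment> \<open>The first \<open>n\<close> points already determine the permutation, which is
      the identity off \<open>{1..n}\<close>.\<close>
    have "\<sigma> i = \<tau> i" for i
    proof (cases "i \<in> {1..n}")
      case True
      then have "x (\<sigma> i) = x (\<tau> i)" using act[OF s] act[OF t] eq by metis
      then show ?thesis
        using x_eq_iff[of "\<sigma> i" "\<tau> i"] perm_mem[OF s True] perm_mem[OF t True] by simp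
    next
      case False
      then show ?thesis using s t permutes_not_in by (metis sym_group_carrier)
    qed
    then show "\<sigma> = \<tau>" by blast
  qed
  ultimately show ?thesis
    by (simp add: faithful_action_def faithful_action_axioms_def group_action_def
        group_hom_def group_hom_axioms_def sym_group_is_group group_BijGroup)
qed

lemma ex_labeling:
  assumes n: "n \<ge> 3"
  shows "\<exists>c. distinguishing_labeling (sym_group n) X \<phi> (n - 1) c"
proof -
  \<comment> \<open>The first \<open>n\<close> points get 1, 1, 2, ..., n - 1, so only indices 1 and
    2 collide among them. The last two points get 1 and 2, which are allowed labels because
    \<open>n \<ge> 3\<close>.\<close>
  define d where "d i = (if i \<le> 2 then 1 else if i \<le> n then i - 1 else i - n)" for i
  define c where "c = d \<circ> inv_into {1..n+2} x"
  have c: "c (x i) = d i" if "i \<in> {1..n+2}" for i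
    using that enum by (simp add: c_def bij_betw_inv_into_left del: atLeastAtMost_iff)
  have "c \<in> X \<rightarrow> {1..n - 1}"
  proof
    fix y assume "y \<in> X"
    then obtain i where "i \<in> {1..n+2}" "y = x i" using enum by (auto simp: bij_betw_def)
    then show "c y \<in> {1..n - 1}" using c n by (auto simp: d_def)
  qed
  moreover have "\<sigma> = id"
    if s: "\<sigma> \<in> carrier (sym_group n)" and inv: "\<forall>y\<in>X. c (\<phi> \<sigma> y) = c y" for \<sigma>
  proof -
    have p: "\<sigma> permutes {1..n}" using s by (simp add: sym_group_def)
    \<comment> \<open>An odd permutation would swap the last two points, whose labels
      differ.\<close>
    have even: "evenperm \<sigma>"
    proof (rule ccontr)
      assume "\<not> evenperm \<sigma>"
      then have "c (x (n+2)) = c (x (n+1))"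
        using act_odd[OF s] inv x_mem[of "n+1"] by auto
      then show False using c n by (simp add: d_def)
    qed
    have d: "d (\<sigma> i) = d i" if "i \<in> {1..n}" for i
    proof -
      have "d (\<sigma> i) = c (\<phi> \<sigma> (x i))"
        using act[OF s that] c[of "\<sigma> i"] perm_mem[OF s that] by simp
      then show ?thesis using inv x_mem[of i] c[of i] that by simp
    qed
    \<comment> \<open>For \<open>3 \<le> i \<le> n\<close> the label \<open>i - 1\<close> occurs
      only once among the first \<open>n\<close> points. Its reuse at \<open>n+2\<close> does no
      harm, since \<open>\<sigma>\<close> keeps \<open>{1..n}\<close> invariant.\<close>
    have fixed: "\<sigma> i = i" if "i \<notin> {1, 2}" for i
    proof (cases "i \<in> {1..n}")
      case True
      then show ?thesis
        using d[OF True] perm_mem[OF s True] that by (auto simp: d_def split: if_splits)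
    qed (use p permutes_not_in in metis)
    have "\<sigma> permutes {1, 2}"
      using permutes_superset[OF p, of "{1, 2}"] fixed by blast
    \<comment> \<open>The transposition is odd, so evenness leaves only the identity.\<close>
    then have "\<sigma> = id \<or> \<sigma> = transpose 1 2"
      by (simp add: permutes_doubleton_iff)
    then show ?thesis using even by (auto simp: evenperm_swap)
  qed
  ultimately show ?thesis by (auto simp: distinguishing_labeling_def sym_group_one)
qed

text \<open>Even permutations fix the last two points, so no choice of labels there can break an
  even symmetry of the labels on the first \<open>n\<close> points.\<close>

lemma labeling_bound:
  assumes lab: "distinguishing_labeling (sym_group n) X \<phi> r c"
  shows "n - 1 \<le> r"
proof (rule ccontr)
  assume "\<not> n - 1 \<le> r"
  then have "r + 1 < n" by simp
  moreover have "c \<circ> x \<in> {1..n} \<rightarrow> {1..r}"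
    using lab x_mem by (fastforce simp: distinguishing_labeling_def)
  ultimately obtain \<sigma> where \<sigma>: "\<sigma> permutes {1..n}" "evenperm \<sigma>" "\<sigma> \<noteq> id"
    and inv: "\<And>i. (c \<circ> x) (\<sigma> i) = (c \<circ> x) i"
    using ex_even_label_preserving by blast
  have s: "\<sigma> \<in> carrier (sym_group n)" using \<sigma>(1) by (simp add: sym_group_def)
  have "c (\<phi> \<sigma> y) = c y" if "y \<in> X" for y
    using that by (cases rule: point_cases) (use act[OF s] act_even[OF s \<sigma>(2)] inv in auto)
  then show False
    using lab s \<sigma>(3) by (auto simp: distinguishing_labeling_def sym_group_one)
qed

end

theorem theorem3p4:
  fixes n :: nat and X :: "'a set" and x :: "nat \<Rightarrow> 'a"
    and \<phi> :: "(nat \<Rightarrow> nat) \<Rightarrow> 'a \<Rightarrow> 'a"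
  assumes "n \<ge> 3"
    and "bij_betw x {1..n+2} X"
    and "\<And>\<sigma>. \<sigma> \<in> carrier (sym_group n) \<Longrightarrow> \<phi> \<sigma> \<in> extensional X"
    and "\<And>\<sigma> i. \<sigma> \<in> carrier (sym_group n) \<Longrightarrow> i \<in> {1..n} \<Longrightarrow> \<phi> \<sigma> (x i) = x (\<sigma> i)"
    and "\<And>\<sigma>. \<sigma> \<in> carrier (sym_group n) \<Longrightarrow> \<not> evenperm \<sigma> \<Longrightarrow>
           \<phi> \<sigma> (x (n+1)) = x (n+2) \<and> \<phi> \<sigma> (x (n+2)) = x (n+1)"
    and "\<And>\<sigma>. \<sigma> \<in> carrier (sym_group n) \<Longrightarrow> evenperm \<sigma> \<Longrightarrow>
           \<phi> \<sigma> (x (n+1)) = x (n+1) \<and> \<phi> \<sigma> (x (n+2)) = x (n+2)"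
  shows "faithful_action (sym_group n) X \<phi> \<and>
         distinguishing_number (sym_group n) X \<phi> = n - 1"
proof -
  interpret parity_extended_action n X x \<phi>
    by unfold_locales (fact assms)+
  have "distinguishing_number (sym_group n) X \<phi> = n - 1"
    unfolding distinguishing_number_def
    using ex_labeling[OF assms(1)] labeling_bound by (intro Least_equality) auto
  then show ?thesis using faithful by blast
qed

end
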